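(* Let $G$ be a finitely generated group with a fixed finite generating set $S$, and let $Q$ be a subset of $G$. Then $Q$ is a quasi-normal subgroup of $G$ if and only if there are a set $L$ and a quasi-homomorphism $\phi:G\to L$ such that $Q=\ker(\phi)$. Moreover, for a quasi-homomorphism $\phi:G\to L$, one has $Q=\ker(\phi)$ if and only if $Q$ is the invariant set $I(\phi)$ of $\phi$.
   Context: For a subgroup $H$ of a group $G$, the commensurator of $H$ in $G$ is $Comm(H,G)=\{g\in G : gHg^{-1}\cap H \text{ has finite index in both } H \text{ and } gHg^{-1}\}$. A subgroup $Q$ of $G$ is quasi-normal in $G$ if $Comm(Q,G)=G$. Let $|\cdot|$ be the word-length norm on $G$ with respect to $S$, $d(a,b)=|b^{-1}a|$ the associated left invariant word metric, and $D$ the corresponding Hausdorff distance on subsets of $G$ (possibly infinite). A function $\phi:G\to L$ from $G$ to a set $L$ is a quasi-homomorphism if there is an integer $k$ such that for all $a,b\in G$, $$D\big(\phi^{-1}(\phi(a))\cdot\phi^{-1}(\phi(b)),\ \phi^{-1}(\phi(ab))\big)\le 2k|b|,$$ where $X\cdot Y=\{xy:x\in X,y\in Y\}$. The kernel of $\phi$ is $\ker(\phi)=\phi^{-1}(\phi(1_G))$. The invariant set of a function $\phi:G\to L$ is $I(\phi)=\{x\in G:\phi(gx)=\phi(g)\text{ for all }g\in G\}$. *)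

theory Defs
  imports "HOL-Algebra.Algebra" "HOL-Library.Extended_Real"
begin

definition finite_index :: "('a, 'm) monoid_scheme \<Rightarrow> 'a set \<Rightarrow> 'a set \<Rightarrow> bool" where
  "finite_index G K H \<longleftrightarrow> finite (rcosets\<^bsub>G\<lparr>carrier := H\<rparr>\<^esub> K)"

definition conjugate :: "('a, 'm) monoid_scheme \<Rightarrow> 'a \<Rightarrow> 'a set \<Rightarrow> 'a set" where
  "conjugate G g H = (g <#\<^bsub>G\<^esub> H) #>\<^bsub>G\<^esub> inv\<^bsub>G\<^esub> g"

definition commensurator :: "('a, 'm) monoid_scheme \<Rightarrow> 'a set \<Rightarrow> 'a set" where
  "commensurator G H = {g \<in> carrier G.
     finite_index G (conjugate G g H \<inter> H) H \<and>
     finite_index G (conjugate G g H \<inter> H) (conjugate G g H)}"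

definition quasi_normal :: "'a set \<Rightarrow> ('a, 'm) monoid_scheme \<Rightarrow> bool" where
  "quasi_normal Q G \<longleftrightarrow> subgroup Q G \<and> commensurator G Q = carrier G"

text \<open>The next definition is meaningful for elements of the subgroup generated by \<open>S\<close>
  (elsewhere the set of lengths is empty).\<close>

definition word_norm :: "('a, 'm) monoid_scheme \<Rightarrow> 'a set \<Rightarrow> 'a \<Rightarrow> nat" where
  "word_norm G S g = (LEAST n. \<exists>ws. length ws = n \<and>
     set ws \<subseteq> S \<union> m_inv G ` S \<and> foldr (\<otimes>\<^bsub>G\<^esub>) ws \<one>\<^bsub>G\<^esub> = g)"

definition word_dist :: "('a, 'm) monoid_scheme \<Rightarrow> 'a set \<Rightarrow> 'a \<Rightarrow> 'a \<Rightarrow> nat" where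
  "word_dist G S a b = word_norm G S (inv\<^bsub>G\<^esub> b \<otimes>\<^bsub>G\<^esub> a)"

text \<open>The word metric is integer-valued, so the Hausdorff distance lies in \<^typ>\<open>enat\<close>.
  In \<^typ>\<open>enat\<close> the infimum of the empty set is \<open>\<infinity>\<close> and its supremum is \<open>0\<close>.\<close>

definition hausdorff_dist :: "('a, 'm) monoid_scheme \<Rightarrow> 'a set \<Rightarrow> 'a set \<Rightarrow> 'a set \<Rightarrow> enat" where
  "hausdorff_dist G S A B =
     max (SUP a\<in>A. INF b\<in>B. enat (word_dist G S a b))
         (SUP b\<in>B. INF a\<in>A. enat (word_dist G S a b))"

definition fiber :: "('a, 'm) monoid_scheme \<Rightarrow> ('a \<Rightarrow> 'l) \<Rightarrow> 'l \<Rightarrow> 'a set" where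
  "fiber G \<phi> y = {x \<in> carrier G. \<phi> x = y}"

text \<open>The comparison is made in \<^typ>\<open>ereal\<close> because the distance may be infinite and
  the integer \<open>k\<close> is not assumed to be nonnegative.\<close>

definition quasi_hom ::
    "('a, 'm) monoid_scheme \<Rightarrow> 'a set \<Rightarrow> 'l set \<Rightarrow> ('a \<Rightarrow> 'l) \<Rightarrow> bool" where
  "quasi_hom G S L \<phi> \<longleftrightarrow> \<phi> \<in> carrier G \<rightarrow> L \<and>
     (\<exists>k::int. \<forall>a\<in>carrier G. \<forall>b\<in>carrier G.
        ereal_of_enat (hausdorff_dist G S
            (fiber G \<phi> (\<phi> a) <#>\<^bsub>G\<^esub> fiber G \<phi> (\<phi> b))
            (fiber G \<phi> (\<phi> (a \<otimes>\<^bsub>G\<^esub> b))))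
        \<le> ereal (2 * real_of_int k * real (word_norm G S b)))"

definition quasi_kernel :: "('a, 'm) monoid_scheme \<Rightarrow> ('a \<Rightarrow> 'l) \<Rightarrow> 'a set" where
  "quasi_kernel G \<phi> = fiber G \<phi> (\<phi> \<one>\<^bsub>G\<^esub>)"

definition invariant_set :: "('a, 'm) monoid_scheme \<Rightarrow> ('a \<Rightarrow> 'l) \<Rightarrow> 'a set" where
  "invariant_set G \<phi> = {x \<in> carrier G. \<forall>g\<in>carrier G. \<phi> (g \<otimes>\<^bsub>G\<^esub> x) = \<phi> g}"

end

theory Submission
  imports Defs
begin

text \<open>Taking \<open>b = \<one>\<close> in the defining inequality of a quasi-homomorphism gives
  \<open>\<phi> (g x) = \<phi> g\<close> for \<open>x\<close> in the kernel \<open>K\<close>, so \<open>K\<close> is the invariant set, a subgroup. Taking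
  \<open>a = b\<inverse>\<close> places \<open>b\<inverse> K b\<close> within bounded distance of \<open>K\<close>; as balls are finite, \<open>b\<inverse> K b\<close> is
  covered by finitely many cosets of \<open>K\<close>, which gives both finite-index conditions.
  Conversely, for quasi-normal \<open>Q\<close> let \<open>\<phi> g = g Q\<close>. Some \<open>c\<close> bounds the distance from
  \<open>s Q\<close> to \<open>Q\<close> for every generator \<open>s\<close>, hence \<open>b Q\<close> and \<open>Q\<close> are at distance at most
  \<open>c |b|\<close>, and by left invariance so are \<open>q b Q\<close> and \<open>q Q = Q\<close>. Going through \<open>Q\<close>, every
  \<open>q b Q\<close> lies within \<open>2 c |b|\<close> of \<open>b Q\<close>.\<close>

section \<open>Pointwise form of bounds on the Hausdorff distance\<close>

lemma hausdorff_dist_le_imp: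
  assumes "hausdorff_dist G S A B \<le> enat n" and "a \<in> A"
  shows "\<exists>b\<in>B. word_dist G S a b \<le> n"
proof -
  have "(INF b\<in>B. enat (word_dist G S a b)) \<le> (SUP a\<in>A. INF b\<in>B. enat (word_dist G S a b))"
    using assms(2) by (rule SUP_upper)
  also have "\<dots> \<le> enat n"
    using assms(1) by (simp add: hausdorff_dist_def)
  \<comment> \<open>A strict bound on the infimum yields a witness in \<open>B\<close>; since the
    metric is integer-valued, distance below \<open>Suc n\<close> is distance at most
    \<open>n\<close>, with no epsilon lost.\<close>
  also have "\<dots> < enat (Suc n)"
    by simp
  finally show ?thesis
    by (auto simp: INF_less_iff less_Suc_eq_le)
qed

lemma hausdorff_dist_leI:
  assumes "\<And>a. a \<in> A \<Longrightarrow> \<exists>b\<in>B. word_dist G S a b \<le> n"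
    and "\<And>b. b \<in> B \<Longrightarrow> \<exists>a\<in>A. word_dist G S a b \<le> n"
  shows "hausdorff_dist G S A B \<le> enat n"
  unfolding hausdorff_dist_def
proof (intro max.boundedI SUP_least)
  fix a assume "a \<in> A"
  then obtain b where "b \<in> B" "word_dist G S a b \<le> n"
    using assms(1) by blast
  then show "(INF b\<in>B. enat (word_dist G S a b)) \<le> enat n"
    by (meson INF_lower2 enat_ord_simps(1))
next
  fix b assume "b \<in> B"
  then obtain a where "a \<in> A" "word_dist G S a b \<le> n"
    using assms(2) by blast
  then show "(INF a\<in>A. enat (word_dist G S a b)) \<le> enat n"
    by (meson INF_lower2 enat_ord_simps(1))
qed

section \<open>Conjugate subgroups and finite index\<close>

context group
begin

lemma mult_inv_mult: "x \<in> carrier G \<Longrightarrow> y \<in> carrier G \<Longrightarrow> x \<otimes> (inv x \<otimes> y) = y"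
  by (simp flip: m_assoc)

lemma inv_mult_mult: "x \<in> carrier G \<Longrightarrow> y \<in> carrier G \<Longrightarrow> inv x \<otimes> (x \<otimes> y) = y"
  by (simp flip: m_assoc)

lemma set_multI: "x \<in> A \<Longrightarrow> y \<in> B \<Longrightarrow> x \<otimes> y \<in> A <#> B"
  by (auto simp: set_mult_def)

lemma conjugate_eq:
  "conjugate G g H = {g \<otimes> h \<otimes> inv g | h. h \<in> H}"
  by (auto simp: conjugate_def l_coset_def r_coset_def)

lemma subgroup_conjugate:
  assumes "subgroup H G" and g: "g \<in> carrier G"
  shows "subgroup (conjugate G g H) G"
proof -
  interpret H: subgroup H G by fact
  show ?thesis
  proof
    show "conjugate G g H \<subseteq> carrier G"
      using g H.subset by (auto simp: conjugate_eq)
    show "\<one> \<in> conjugate G g H"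
      using g H.one_closed by (auto simp: conjugate_eq intro!: exI[of _ \<one>])
    show "x \<otimes> y \<in> conjugate G g H" if xy: "x \<in> conjugate G g H" "y \<in> conjugate G g H" for x y
    proof -
      obtain h k where hk: "h \<in> H" "k \<in> H" "x = g \<otimes> h \<otimes> inv g" "y = g \<otimes> k \<otimes> inv g"
        using xy by (auto simp: conjugate_eq)
      then have "x \<otimes> y = g \<otimes> (h \<otimes> k) \<otimes> inv g"
        using g by (simp add: m_assoc inv_mult_mult)
      then show ?thesis
        using hk by (auto simp: conjugate_eq)
    qed
    show "inv x \<in> conjugate G g H" if x: "x \<in> conjugate G g H" for x
    proof -
      obtain h where h: "h \<in> H" "x = g \<otimes> h \<otimes> inv g"
        using x by (auto simp: conjugate_eq)
      then have "inv x = g \<otimes> inv h \<otimes> inv g"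
        using g by (simp add: m_assoc inv_mult_group)
      then show ?thesis
        using h by (auto simp: conjugate_eq)
    qed
  qed
qed

text \<open>The right cosets of \<open>K \<inter> H\<close> in \<open>H\<close> are the traces on
  \<open>H\<close> of the right cosets of \<open>K\<close> that meet \<open>H\<close>. The set
  \<open>T\<close> ranges over subsets of \<open>carrier G\<close> rather than of \<open>H\<close>,
  so that a ball of the word metric can serve as a witness.\<close>

lemma finite_index_iff_finite_cover:
  assumes "subgroup H G" and "subgroup K G"
  shows "finite_index G (K \<inter> H) H \<longleftrightarrow> (\<exists>T. finite T \<and> T \<subseteq> carrier G \<and> H \<subseteq> K <#> T)"
proof -
  interpret H: subgroup H G by fact
  interpret K: subgroup K G by fact
  have rcosets: "rcosets\<^bsub>G\<lparr>carrier := H\<rparr>\<^esub> (K \<inter> H) = (\<lambda>h. (K \<inter> H) #> h) ` H"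
    by (auto simp: RCOSETS_def r_coset_def)
  show ?thesis
  proof
    assume "finite_index G (K \<inter> H) H"
    then obtain T where T: "finite T" "T \<subseteq> H"
        "(\<lambda>h. (K \<inter> H) #> h) ` H = (\<lambda>h. (K \<inter> H) #> h) ` T"
      unfolding finite_index_def rcosets using finite_subset_image by (metis order_refl)
    have "h \<in> K <#> T" if "h \<in> H" for h
    proof -
      have "(K \<inter> H) #> h \<in> (\<lambda>h. (K \<inter> H) #> h) ` T"
        using that by (simp flip: T(3))
      then obtain t where t: "t \<in> T" "(K \<inter> H) #> h = (K \<inter> H) #> t"
        by blast
      have "h \<in> (K \<inter> H) #> h"
        using that by (auto simp: r_coset_def intro!: bexI[of _ \<one>])
      then have "h \<in> (K \<inter> H) #> t"
        by (simp only: t(2))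
      then obtain k where "k \<in> K" "h = k \<otimes> t"
        by (auto simp: r_coset_def)
      then show ?thesis
        using t(1) unfolding set_mult_def by blast
    qed
    then have "H \<subseteq> K <#> T"
      by (rule subsetI)
    moreover have "T \<subseteq> carrier G"
      using T(2) H.subset by (rule order_trans)
    ultimately show "\<exists>T. finite T \<and> T \<subseteq> carrier G \<and> H \<subseteq> K <#> T"
      using T(1) by (intro exI conjI)
  next
    assume "\<exists>T. finite T \<and> T \<subseteq> carrier G \<and> H \<subseteq> K <#> T"
    then obtain T where T: "finite T" "T \<subseteq> carrier G" "H \<subseteq> K <#> T"
      by blast
    \<comment> \<open>Each coset is shown to be the trace of some \<open>K #> t\<close>, so there
      are at most as many cosets as elements of \<open>T\<close>. The trace formula rests on this:
      \<open>k \<otimes> h\<close> and \<open>h\<close> in \<open>H\<close> force \<open>k\<close>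
      into \<open>H\<close>.\<close>
    have "(K \<inter> H) #> h \<in> (\<lambda>t. (K #> t) \<inter> H) ` T" if h: "h \<in> H" for h
    proof -
      have "h \<in> K <#> T"
        using T(3) h by (rule subsetD)
      then obtain t where t: "t \<in> T" "h \<in> K #> t"
        by (auto simp: set_mult_def r_coset_def)
      have "K #> h = K #> t"
        using t T(2) assms(2) repr_independence by (metis subsetD)
      moreover have "(K \<inter> H) #> h = (K #> h) \<inter> H"
      proof -
        have "k \<in> H" if "k \<in> K" "k \<otimes> h \<in> H" for k
          using that h by (metis H.m_closed H.m_inv_closed H.mem_carrier K.mem_carrier inv_solve_right')
        then show ?thesis
          using h by (auto simp: r_coset_def)
      qed
      ultimately show ?thesis
        using t(1) by blast
    qed
    then show "finite_index G (K \<inter> H) H"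
      unfolding finite_index_def rcosets using T(1)
      by (meson finite_imageI finite_subset image_subsetI)
  qed
qed

end

section \<open>The word norm of a finitely generated group\<close>

locale finitely_generated_group = group G for G (structure) +
  fixes S
  assumes finite_gens: "finite S" and gens_closed: "S \<subseteq> carrier G"
    and generate_gens: "generate G S = carrier G"
begin

abbreviation letters where "letters \<equiv> S \<union> m_inv G ` S"

abbreviation eval_word where "eval_word ws \<equiv> foldr (\<otimes>) ws \<one>"

abbreviation norm_S ("\<bar>_\<bar>\<^sub>S") where "norm_S \<equiv> word_norm G S"

lemma letters_closed: "letters \<subseteq> carrier G"
  using gens_closed by auto

lemma inv_letter: "s \<in> letters \<Longrightarrow> inv s \<in> letters"
  using gens_closed by auto

lemma set_inv_word: "set ws \<subseteq> letters \<Longrightarrow> set (rev (map (m_inv G) ws)) \<subseteq> letters"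
  using inv_letter by (simp only: set_rev set_map) blast

lemma eval_word_closed: "set ws \<subseteq> letters \<Longrightarrow> eval_word ws \<in> carrier G"
proof (induction ws)
  case (Cons s ws)
  then have "s \<in> carrier G"
    using letters_closed by auto
  with Cons show ?case by simp
qed simp

lemma eval_word_append:
  "set us \<subseteq> letters \<Longrightarrow> set vs \<subseteq> letters \<Longrightarrow> eval_word (us @ vs) = eval_word us \<otimes> eval_word vs"
proof (induction us)
  case Nil
  then show ?case using eval_word_closed by simp
next
  case (Cons s us)
  then have "s \<in> carrier G" "eval_word us \<in> carrier G" "eval_word vs \<in> carrier G"
    using letters_closed eval_word_closed by auto
  with Cons show ?case by (simp add: m_assoc)
qed

lemma inv_eval_word:
  "set ws \<subseteq> letters \<Longrightarrow> inv (eval_word ws) = eval_word (rev (map (m_inv G) ws))"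
proof (induction ws)
  case (Cons s ws)
  then have "s \<in> carrier G" "eval_word ws \<in> carrier G"
    using letters_closed eval_word_closed by auto
  moreover have "eval_word (rev (map (m_inv G) ws) @ [inv s])
      = eval_word (rev (map (m_inv G) ws)) \<otimes> eval_word [inv s]"
    using set_inv_word[OF Cons.prems] by (intro eval_word_append) simp_all
  ultimately show ?case
    using Cons by (simp add: inv_mult_group)
qed simp

lemma word_norm_le:
  "set ws \<subseteq> letters \<Longrightarrow> \<bar>eval_word ws\<bar>\<^sub>S \<le> length ws"
  unfolding word_norm_def by (rule Least_le) blast

lemma ex_word: "g \<in> generate G S \<Longrightarrow> \<exists>ws. set ws \<subseteq> letters \<and> eval_word ws = g"
proof (induction rule: generate.induct)
  case one
  show ?case by (intro exI[of _ "[]"]) simp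
next
  case (incl h)
  then show ?case using gens_closed by (intro exI[of _ "[h]"]) auto
next
  case (inv h)
  then show ?case using gens_closed by (intro exI[of _ "[inv h]"]) auto
next
  case (eng g h)
  then obtain us vs where "set us \<subseteq> letters" "eval_word us = g"
      "set vs \<subseteq> letters" "eval_word vs = h"
    by blast
  then show ?case
    using eval_word_append by (intro exI[of _ "us @ vs"]) auto
qed

text \<open>Because \<open>S\<close> generates \<open>G\<close>, the set of lengths under
  \<open>LEAST\<close> in \<open>word_norm\<close> is nonempty, so its minimum is attained by an
  actual word.\<close>

lemma ex_shortest_word:
  assumes "g \<in> carrier G"
  obtains ws where "set ws \<subseteq> letters" "eval_word ws = g" "length ws = \<bar>g\<bar>\<^sub>S"
proof -
  obtain ws where "set ws \<subseteq> letters" "eval_word ws = g"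
    using assms ex_word generate_gens by blast
  then have "\<exists>n ws. length ws = n \<and> set ws \<subseteq> letters \<and> eval_word ws = g"
    by blast
  from LeastI_ex[OF this] show ?thesis
    using that unfolding word_norm_def by blast
qed

lemma word_norm_mult:
  assumes "g \<in> carrier G" "h \<in> carrier G"
  shows "\<bar>g \<otimes> h\<bar>\<^sub>S \<le> \<bar>g\<bar>\<^sub>S + \<bar>h\<bar>\<^sub>S"
proof -
  obtain us where us: "set us \<subseteq> letters" "eval_word us = g" "length us = \<bar>g\<bar>\<^sub>S"
    using assms(1) by (rule ex_shortest_word)
  obtain vs where vs: "set vs \<subseteq> letters" "eval_word vs = h" "length vs = \<bar>h\<bar>\<^sub>S"
    using assms(2) by (rule ex_shortest_word)
  have "\<bar>eval_word (us @ vs)\<bar>\<^sub>S \<le> length (us @ vs)"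
    using us vs by (intro word_norm_le) auto
  then show ?thesis
    using us vs by (simp only: eval_word_append length_append)
qed

text \<open>Reversing a shortest word and inverting its letters spells the inverse.\<close>

lemma word_norm_inv_le:
  assumes "g \<in> carrier G"
  shows "\<bar>inv g\<bar>\<^sub>S \<le> \<bar>g\<bar>\<^sub>S"
proof -
  obtain ws where ws: "set ws \<subseteq> letters" "eval_word ws = g" "length ws = \<bar>g\<bar>\<^sub>S"
    using assms by (rule ex_shortest_word)
  from word_norm_le[OF set_inv_word[OF ws(1)]] show ?thesis
    using ws inv_eval_word[OF ws(1)] by simp
qed

lemma word_norm_one: "\<bar>\<one>\<bar>\<^sub>S = 0"
  using word_norm_le[of "[]"] by simp

lemma word_norm_eq_0D: "g \<in> carrier G \<Longrightarrow> \<bar>g\<bar>\<^sub>S = 0 \<Longrightarrow> g = \<one>"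
  by (elim ex_shortest_word) auto

text \<open>A finite alphabet has only finitely many words of bounded length. This is what turns
  bounded distance between subgroups into finite coset covers.\<close>

lemma finite_ball: "finite {g \<in> carrier G. \<bar>g\<bar>\<^sub>S \<le> n}"
proof (rule finite_subset)
  show "{g \<in> carrier G. \<bar>g\<bar>\<^sub>S \<le> n} \<subseteq> eval_word ` {ws. set ws \<subseteq> letters \<and> length ws \<le> n}"
  proof clarify
    fix g assume g: "g \<in> carrier G" "\<bar>g\<bar>\<^sub>S \<le> n"
    then obtain ws where "set ws \<subseteq> letters" "eval_word ws = g" "length ws = \<bar>g\<bar>\<^sub>S"
      by (rule_tac ex_shortest_word)
    with g(2) show "g \<in> eval_word ` {ws. set ws \<subseteq> letters \<and> length ws \<le> n}"
      by auto
  qed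
  show "finite (eval_word ` {ws. set ws \<subseteq> letters \<and> length ws \<le> n})"
    using finite_gens by (intro finite_imageI finite_lists_length_le) auto
qed

subsection \<open>Quasi-homomorphisms\<close>

text \<open>Keeps the half of the Hausdorff bound that sends a product of fibers near the target
  fiber. The new \<open>k\<close> is a natural number that absorbs the factor 2.\<close>

lemma quasi_homD:
  assumes "quasi_hom G S L \<phi>"
  obtains k where "\<And>a b x y. \<lbrakk>a \<in> carrier G; b \<in> carrier G; x \<in> fiber G \<phi> (\<phi> a); y \<in> fiber G \<phi> (\<phi> b)\<rbrakk>
    \<Longrightarrow> \<exists>z\<in>fiber G \<phi> (\<phi> (a \<otimes> b)). \<bar>inv z \<otimes> (x \<otimes> y)\<bar>\<^sub>S \<le> k * \<bar>b\<bar>\<^sub>S"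
proof -
  obtain k :: int where k: "\<And>a b. \<lbrakk>a \<in> carrier G; b \<in> carrier G\<rbrakk> \<Longrightarrow>
      ereal_of_enat (hausdorff_dist G S (fiber G \<phi> (\<phi> a) <#> fiber G \<phi> (\<phi> b)) (fiber G \<phi> (\<phi> (a \<otimes> b))))
        \<le> ereal (2 * real_of_int k * real \<bar>b\<bar>\<^sub>S)"
    using assms unfolding quasi_hom_def by blast
  show thesis
  proof (rule that)
    fix a b x y
    assume *: "a \<in> carrier G" "b \<in> carrier G" "x \<in> fiber G \<phi> (\<phi> a)" "y \<in> fiber G \<phi> (\<phi> b)"
    let ?D = "hausdorff_dist G S (fiber G \<phi> (\<phi> a) <#> fiber G \<phi> (\<phi> b)) (fiber G \<phi> (\<phi> (a \<otimes> b)))"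
    \<comment> \<open>A negative \<open>k\<close> is replaced by 0, which only weakens the
      bound.\<close>
    have "real_of_int k \<le> real (nat k)"
      by simp
    then have "2 * real_of_int k * real \<bar>b\<bar>\<^sub>S \<le> 2 * real (nat k) * real \<bar>b\<bar>\<^sub>S"
      by (intro mult_right_mono mult_left_mono) auto
    also have "\<dots> = real (2 * nat k * \<bar>b\<bar>\<^sub>S)"
      by simp
    finally have "ereal (2 * real_of_int k * real \<bar>b\<bar>\<^sub>S) \<le> ereal_of_enat (enat (2 * nat k * \<bar>b\<bar>\<^sub>S))"
      by simp
    with k[OF *(1,2)] have "ereal_of_enat ?D \<le> ereal_of_enat (enat (2 * nat k * \<bar>b\<bar>\<^sub>S))"
      by (rule order_trans)
    then have D: "?D \<le> enat (2 * nat k * \<bar>b\<bar>\<^sub>S)"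
      by (simp only: ereal_of_enat_le_iff)
    have xy: "x \<otimes> y \<in> fiber G \<phi> (\<phi> a) <#> fiber G \<phi> (\<phi> b)"
      using *(3,4) by (auto simp: set_mult_def)
    show "\<exists>z\<in>fiber G \<phi> (\<phi> (a \<otimes> b)). \<bar>inv z \<otimes> (x \<otimes> y)\<bar>\<^sub>S \<le> (2 * nat k) * \<bar>b\<bar>\<^sub>S"
      using hausdorff_dist_le_imp[OF D xy] by (simp only: word_dist_def)
  qed
qed

lemma quasi_kernel_eq_invariant_set:
  assumes "quasi_hom G S L \<phi>"
  shows "quasi_kernel G \<phi> = invariant_set G \<phi>"
proof
  obtain k where k: "\<And>a b x y. \<lbrakk>a \<in> carrier G; b \<in> carrier G; x \<in> fiber G \<phi> (\<phi> a); y \<in> fiber G \<phi> (\<phi> b)\<rbrakk>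
    \<Longrightarrow> \<exists>z\<in>fiber G \<phi> (\<phi> (a \<otimes> b)). \<bar>inv z \<otimes> (x \<otimes> y)\<bar>\<^sub>S \<le> k * \<bar>b\<bar>\<^sub>S"
    using quasi_homD[OF assms] by blast
  show "quasi_kernel G \<phi> \<subseteq> invariant_set G \<phi>"
  proof
    fix x assume x: "x \<in> quasi_kernel G \<phi>"
    then have xG: "x \<in> carrier G"
      by (simp add: quasi_kernel_def fiber_def)
    have "\<phi> (g \<otimes> x) = \<phi> g" if g: "g \<in> carrier G" for g
    proof -
      have "g \<in> fiber G \<phi> (\<phi> g)"
        using g by (simp add: fiber_def)
      \<comment> \<open>With \<open>b = \<one>\<close> the right-hand side is 0, so
        \<open>g \<otimes> x\<close> is not merely near the fiber of \<open>\<phi> g\<close> but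
        equal to its element \<open>z\<close>.\<close>
      then obtain z where z: "z \<in> fiber G \<phi> (\<phi> (g \<otimes> \<one>))" "\<bar>inv z \<otimes> (g \<otimes> x)\<bar>\<^sub>S \<le> k * \<bar>\<one>\<bar>\<^sub>S"
        using k[of g \<one> g x] g x unfolding quasi_kernel_def by blast
      then have zG: "z \<in> carrier G" "\<phi> z = \<phi> g"
        using g by (auto simp: fiber_def)
      then have "inv z \<otimes> (g \<otimes> x) = \<one>"
        using z(2) g xG by (intro word_norm_eq_0D) (auto simp: word_norm_one)
      then have "g \<otimes> x = z"
        using zG g xG by (metis inv_solve_left' m_closed one_closed r_one)
      then show ?thesis
        using zG by simp
    qed
    then show "x \<in> invariant_set G \<phi>"
      using xG by (simp add: invariant_set_def)
  qed
  show "invariant_set G \<phi> \<subseteq> quasi_kernel G \<phi>"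
    unfolding invariant_set_def quasi_kernel_def fiber_def using l_one one_closed by fastforce
qed

text \<open>This is the stabilizer of \<open>\<phi>\<close> under the action of \<open>G\<close> on
  functions by right translation.\<close>

lemma subgroup_invariant_set: "subgroup (invariant_set G \<phi>) G"
proof
  show "x \<otimes> y \<in> invariant_set G \<phi>" if "x \<in> invariant_set G \<phi>" "y \<in> invariant_set G \<phi>" for x y
    using that by (simp add: invariant_set_def flip: m_assoc)
  show "inv x \<in> invariant_set G \<phi>" if "x \<in> invariant_set G \<phi>" for x
  proof -
    have "\<phi> (g \<otimes> inv x) = \<phi> g" if g: "g \<in> carrier G" for g
    proof -
      \<comment> \<open>Invariance under \<open>x\<close> is applied at the point
        \<open>g \<otimes> inv x\<close>.\<close>
      have "\<phi> (g \<otimes> inv x \<otimes> x) = \<phi> (g \<otimes> inv x)"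
        using \<open>x \<in> _\<close> g by (simp add: invariant_set_def)
      moreover have "g \<otimes> inv x \<otimes> x = g"
        using \<open>x \<in> _\<close> g by (simp add: invariant_set_def m_assoc)
      ultimately show ?thesis by simp
    qed
    then show ?thesis
      using that by (simp add: invariant_set_def)
  qed
qed (auto simp: invariant_set_def)

lemma quasi_normal_quasi_kernel:
  assumes "quasi_hom G S L \<phi>"
  shows "quasi_normal (quasi_kernel G \<phi>) G"
proof -
  define K where "K = quasi_kernel G \<phi>"
  have K_inv: "K = invariant_set G \<phi>"
    using quasi_kernel_eq_invariant_set[OF assms] by (simp add: K_def)
  have sub: "subgroup K G"
    unfolding K_inv by (rule subgroup_invariant_set)
  interpret K: subgroup K G by (rule sub)
  obtain k where k: "\<And>a b x y. \<lbrakk>a \<in> carrier G; b \<in> carrier G; x \<in> fiber G \<phi> (\<phi> a); y \<in> fiber G \<phi> (\<phi> b)\<rbrakk>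
    \<Longrightarrow> \<exists>z\<in>fiber G \<phi> (\<phi> (a \<otimes> b)). \<bar>inv z \<otimes> (x \<otimes> y)\<bar>\<^sub>S \<le> k * \<bar>b\<bar>\<^sub>S"
    using quasi_homD[OF assms] by blast
  \<comment> \<open>Here \<open>a = inv b\<close>, so the target fiber is that of
    \<open>\<one>\<close>, namely \<open>K\<close>. Right invariance under \<open>x\<close> keeps
    \<open>inv b \<otimes> x\<close> in the fiber of \<open>inv b\<close>.\<close>
  have near: "\<exists>z\<in>K. \<bar>inv z \<otimes> (inv b \<otimes> x \<otimes> b)\<bar>\<^sub>S \<le> k * \<bar>b\<bar>\<^sub>S" if b: "b \<in> carrier G" and x: "x \<in> K" for b x
  proof -
    have "inv b \<otimes> x \<in> fiber G \<phi> (\<phi> (inv b))" "b \<in> fiber G \<phi> (\<phi> b)"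
      using b x unfolding K_inv by (auto simp: fiber_def invariant_set_def)
    moreover have "fiber G \<phi> (\<phi> (inv b \<otimes> b)) = K"
      using b by (simp add: K_def quasi_kernel_def)
    ultimately show ?thesis
      using k[of "inv b" b "inv b \<otimes> x" b] b by auto
  qed
  have "g \<in> commensurator G K" if g: "g \<in> carrier G" for g
  proof -
    let ?C = "conjugate G g K"
    let ?B = "{t \<in> carrier G. \<bar>t\<bar>\<^sub>S \<le> k * \<bar>g\<bar>\<^sub>S}"
    let ?B' = "{t \<in> carrier G. \<bar>t\<bar>\<^sub>S \<le> k * \<bar>inv g\<bar>\<^sub>S}"
    have C: "subgroup ?C G"
      using sub g by (rule subgroup_conjugate)
    \<comment> \<open>Using \<open>near\<close> at \<open>inv g\<close> places
      \<open>g \<otimes> h \<otimes> inv g\<close> in \<open>z\<close> times a ball, so the ball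
      itself is the finite cover.\<close>
    have "x \<in> K <#> ?B'" if x: "x \<in> ?C" for x
    proof -
      obtain h where h: "h \<in> K" "x = g \<otimes> h \<otimes> inv g"
        using x by (auto simp: conjugate_eq)
      obtain z where z: "z \<in> K" "\<bar>inv z \<otimes> x\<bar>\<^sub>S \<le> k * \<bar>inv g\<bar>\<^sub>S"
        using near[of "inv g" h] g h by auto
      moreover have "x = z \<otimes> (inv z \<otimes> x)"
        using h z g by (simp add: m_assoc mult_inv_mult)
      ultimately show ?thesis
        using set_multI[of z K "inv z \<otimes> x" ?B'] h g by auto
    qed
    then have "finite_index G (K \<inter> ?C) ?C"
      using finite_index_iff_finite_cover[OF C sub] finite_ball by blast
    \<comment> \<open>For the other index, \<open>near\<close> at \<open>g\<close> writes
      \<open>inv g \<otimes> x \<otimes> g\<close> as \<open>z \<otimes> t\<close> with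
      \<open>t\<close> in a ball; conjugating both factors back by \<open>g\<close> gives a cover by
      a conjugated ball.\<close>
    moreover have "x \<in> ?C <#> (\<lambda>t. g \<otimes> t \<otimes> inv g) ` ?B" if x: "x \<in> K" for x
    proof -
      obtain z where z: "z \<in> K" "\<bar>inv z \<otimes> (inv g \<otimes> x \<otimes> g)\<bar>\<^sub>S \<le> k * \<bar>g\<bar>\<^sub>S"
        using near[OF g x] by blast
      define t where "t = inv z \<otimes> (inv g \<otimes> x \<otimes> g)"
      have "t \<in> ?B"
        using z g x by (simp add: t_def)
      moreover have "x = (g \<otimes> z \<otimes> inv g) \<otimes> (g \<otimes> t \<otimes> inv g)"
        using g z x by (simp add: t_def m_assoc inv_mult_mult mult_inv_mult)
      moreover have "g \<otimes> z \<otimes> inv g \<in> ?C"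
        using z by (auto simp: conjugate_eq)
      ultimately show ?thesis
        by (metis (no_types, lifting) imageI set_multI)
    qed
    moreover have "(\<lambda>t. g \<otimes> t \<otimes> inv g) ` ?B \<subseteq> carrier G"
      using g by auto
    ultimately show ?thesis
      using finite_index_iff_finite_cover[OF sub C] finite_ball g
      unfolding commensurator_def by (simp add: Int_commute) (meson finite_imageI subsetI)
  qed
  then show ?thesis
    using sub unfolding quasi_normal_def commensurator_def K_def by blast
qed

section \<open>From quasi-normal subgroups to quasi-homomorphisms\<close>

lemma quasi_normal_linear_displacement:
  assumes "quasi_normal Q G"
  obtains c where "\<And>g q. \<lbrakk>g \<in> carrier G; q \<in> Q\<rbrakk> \<Longrightarrow> \<exists>r\<in>Q. \<bar>inv r \<otimes> (g \<otimes> q)\<bar>\<^sub>S \<le> c * \<bar>g\<bar>\<^sub>S"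
proof -
  have sub: "subgroup Q G" and comm: "commensurator G Q = carrier G"
    using assms by (auto simp: quasi_normal_def)
  interpret Q: subgroup Q G by (rule sub)
  have "\<exists>c. \<forall>q\<in>Q. \<exists>r\<in>Q. \<bar>inv r \<otimes> (s \<otimes> q)\<bar>\<^sub>S \<le> c" if s: "s \<in> carrier G" for s
  proof -
    have "finite_index G (Q \<inter> conjugate G s Q) (conjugate G s Q)"
      using s comm unfolding commensurator_def by (auto simp: Int_commute)
    then obtain T where T: "finite T" "T \<subseteq> carrier G" "conjugate G s Q \<subseteq> Q <#> T"
      using finite_index_iff_finite_cover[OF subgroup_conjugate[OF sub s] sub] by blast
    \<comment> \<open>If \<open>s \<otimes> q \<otimes> inv s = r \<otimes> t\<close> with
      \<open>t \<in> T\<close>, then \<open>inv r \<otimes> (s \<otimes> q) = t \<otimes> s\<close>,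
      which takes only finitely many values as \<open>q\<close> varies.\<close>
    have "\<exists>r\<in>Q. \<bar>inv r \<otimes> (s \<otimes> q)\<bar>\<^sub>S \<le> Max ((\<lambda>t. \<bar>t \<otimes> s\<bar>\<^sub>S) ` T)" if q: "q \<in> Q" for q
    proof -
      have "s \<otimes> q \<otimes> inv s \<in> Q <#> T"
        using T(3) q by (auto simp: conjugate_eq)
      then obtain r t where rt: "r \<in> Q" "t \<in> T" "s \<otimes> q \<otimes> inv s = r \<otimes> t"
        by (auto simp: set_mult_def)
      have tG: "t \<in> carrier G"
        using rt T by blast
      have "s \<otimes> q = r \<otimes> t \<otimes> s"
        using rt(1,3) tG s q by (metis Q.mem_carrier inv_solve_right' m_closed)
      then have "inv r \<otimes> (s \<otimes> q) = t \<otimes> s"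
        using rt(1) tG s by (simp add: m_assoc inv_mult_mult)
      then show ?thesis
        using rt T(1) by (auto intro!: bexI[of _ r])
    qed
    then show ?thesis by blast
  qed
  then have "\<forall>s\<in>letters. \<exists>c. \<forall>q\<in>Q. \<exists>r\<in>Q. \<bar>inv r \<otimes> (s \<otimes> q)\<bar>\<^sub>S \<le> c"
    using letters_closed by blast
  then obtain c where c: "\<And>s q. \<lbrakk>s \<in> letters; q \<in> Q\<rbrakk> \<Longrightarrow> \<exists>r\<in>Q. \<bar>inv r \<otimes> (s \<otimes> q)\<bar>\<^sub>S \<le> c s"
    by metis
  \<comment> \<open>For empty \<open>S\<close> this \<open>Max\<close> is unspecified, but then
    there is no letter to bound and only the empty word remains, where \<open>C\<close> is
    multiplied by 0.\<close>
  define C where "C = Max (c ` letters)"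
  have C: "\<exists>r\<in>Q. \<bar>inv r \<otimes> (s \<otimes> q)\<bar>\<^sub>S \<le> C" if "s \<in> letters" "q \<in> Q" for s q
  proof -
    have "c s \<le> C"
      unfolding C_def using that finite_gens by (intro Max_ge) auto
    then show ?thesis
      using c[OF that] order_trans by blast
  qed
  have word: "\<exists>r\<in>Q. \<bar>inv r \<otimes> (eval_word ws \<otimes> q)\<bar>\<^sub>S \<le> C * length ws"
    if "set ws \<subseteq> letters" "q \<in> Q" for ws q
    using that
  proof (induction ws)
    case Nil
    then show ?case by (auto simp: word_norm_one intro!: bexI[of _ q])
  next
    case (Cons s ws)
    let ?w = "eval_word ws"
    have sw: "s \<in> carrier G" "?w \<in> carrier G"
      using Cons.prems letters_closed eval_word_closed by auto
    \<comment> \<open>The inner word brings \<open>q\<close> near \<open>p\<close>, and the letter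
      \<open>s\<close> brings \<open>p\<close> near \<open>r\<close>. Left translation by
      \<open>s\<close> preserves the first distance, so the two bounds add.\<close>
    obtain p where p: "p \<in> Q" "\<bar>inv p \<otimes> (?w \<otimes> q)\<bar>\<^sub>S \<le> C * length ws"
      using Cons by auto
    obtain r where r: "r \<in> Q" "\<bar>inv r \<otimes> (s \<otimes> p)\<bar>\<^sub>S \<le> C"
      using C[of s p] Cons.prems p(1) by auto
    have "inv r \<otimes> (s \<otimes> ?w \<otimes> q) = (inv r \<otimes> (s \<otimes> p)) \<otimes> (inv p \<otimes> (?w \<otimes> q))"
      using sw p(1) r(1) Cons.prems(2) by (simp add: m_assoc mult_inv_mult)
    then have "\<bar>inv r \<otimes> (s \<otimes> ?w \<otimes> q)\<bar>\<^sub>S \<le> \<bar>inv r \<otimes> (s \<otimes> p)\<bar>\<^sub>S + \<bar>inv p \<otimes> (?w \<otimes> q)\<bar>\<^sub>S"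
      using sw p(1) r(1) Cons.prems(2) by (simp add: word_norm_mult)
    then show ?case
      using p(2) r by (intro bexI[of _ r]) auto
  qed
  show thesis
  proof (rule that)
    fix g q assume gq: "g \<in> carrier G" "q \<in> Q"
    obtain ws where "set ws \<subseteq> letters" "eval_word ws = g" "length ws = \<bar>g\<bar>\<^sub>S"
      using gq(1) by (rule ex_shortest_word)
    then show "\<exists>r\<in>Q. \<bar>inv r \<otimes> (g \<otimes> q)\<bar>\<^sub>S \<le> C * \<bar>g\<bar>\<^sub>S"
      using word[of ws q] gq(2) by auto
  qed
qed

lemma fiber_l_coset:
  assumes "subgroup Q G" "a \<in> carrier G"
  shows "fiber G (\<lambda>g. g <#\<^bsub>G\<^esub> Q) (a <#\<^bsub>G\<^esub> Q) = a <#\<^bsub>G\<^esub> Q"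
proof
  interpret Q: subgroup Q G by fact
  show "fiber G (\<lambda>g. g <#\<^bsub>G\<^esub> Q) (a <#\<^bsub>G\<^esub> Q) \<subseteq> a <#\<^bsub>G\<^esub> Q"
    by (force simp: fiber_def l_coset_def)
  show "a <#\<^bsub>G\<^esub> Q \<subseteq> fiber G (\<lambda>g. g <#\<^bsub>G\<^esub> Q) (a <#\<^bsub>G\<^esub> Q)"
    using assms l_repr_independence l_coset_carrier by (simp add: fiber_def) blast
qed

lemma quasi_hom_l_coset:
  assumes "quasi_normal Q G"
  shows "quasi_hom G S UNIV (\<lambda>g. g <#\<^bsub>G\<^esub> Q)"
proof -
  have sub: "subgroup Q G"
    using assms by (auto simp: quasi_normal_def)
  interpret Q: subgroup Q G by (rule sub)
  obtain c where c: "\<And>g q. \<lbrakk>g \<in> carrier G; q \<in> Q\<rbrakk> \<Longrightarrow> \<exists>r\<in>Q. \<bar>inv r \<otimes> (g \<otimes> q)\<bar>\<^sub>S \<le> c * \<bar>g\<bar>\<^sub>S"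
    using quasi_normal_linear_displacement[OF assms] by blast
  have D: "hausdorff_dist G S ((a <#\<^bsub>G\<^esub> Q) <#> (b <#\<^bsub>G\<^esub> Q)) ((a \<otimes> b) <#\<^bsub>G\<^esub> Q) \<le> enat (2 * c * \<bar>b\<bar>\<^sub>S)"
    if a: "a \<in> carrier G" and b: "b \<in> carrier G" for a b
  proof (rule hausdorff_dist_leI)
    fix x assume "x \<in> (a <#\<^bsub>G\<^esub> Q) <#> (b <#\<^bsub>G\<^esub> Q)"
    then obtain p q where x: "p \<in> Q" "q \<in> Q" "x = a \<otimes> p \<otimes> (b \<otimes> q)"
      by (auto simp: set_mult_def l_coset_def)
    \<comment> \<open>The path from \<open>x\<close> to the coset of \<open>a \<otimes> b\<close>
      goes through \<open>Q\<close>: first \<open>b \<otimes> q\<close> is moved to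
      \<open>r\<close>, then \<open>p \<otimes> r\<close>, again in \<open>Q\<close>, is moved back
      to \<open>b \<otimes> z\<close> by the displacement bound for \<open>inv b\<close>. The factor
      \<open>a\<close> cancels by left invariance.\<close>
    obtain r where r: "r \<in> Q" "\<bar>inv r \<otimes> (b \<otimes> q)\<bar>\<^sub>S \<le> c * \<bar>b\<bar>\<^sub>S"
      using c[OF b x(2)] by blast
    obtain z where z: "z \<in> Q" "\<bar>inv z \<otimes> (inv b \<otimes> (p \<otimes> r))\<bar>\<^sub>S \<le> c * \<bar>inv b\<bar>\<^sub>S"
      using c[of "inv b" "p \<otimes> r"] b x(1) r(1) by auto
    have "inv (a \<otimes> b \<otimes> z) \<otimes> x = (inv z \<otimes> (inv b \<otimes> (p \<otimes> r))) \<otimes> (inv r \<otimes> (b \<otimes> q))"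
      using a b x r(1) z(1) by (simp add: m_assoc inv_mult_group inv_mult_mult mult_inv_mult)
    then have "word_dist G S x (a \<otimes> b \<otimes> z)
        \<le> \<bar>inv z \<otimes> (inv b \<otimes> (p \<otimes> r))\<bar>\<^sub>S + \<bar>inv r \<otimes> (b \<otimes> q)\<bar>\<^sub>S"
      unfolding word_dist_def
      using b x(1,2) r(1) z(1)
        word_norm_mult[of "inv z \<otimes> (inv b \<otimes> (p \<otimes> r))" "inv r \<otimes> (b \<otimes> q)"] by simp
    also have "\<dots> \<le> c * \<bar>b\<bar>\<^sub>S + c * \<bar>b\<bar>\<^sub>S"
      using z(2) r(2) word_norm_inv_le[OF b] by (meson add_mono mult_le_mono2 order_trans)
    finally show "\<exists>y\<in>(a \<otimes> b) <#\<^bsub>G\<^esub> Q. word_dist G S x y \<le> 2 * c * \<bar>b\<bar>\<^sub>S"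
      using z(1) by (intro bexI[of _ "a \<otimes> b \<otimes> z"]) (auto simp: l_coset_def)
  next
    fix y assume "y \<in> (a \<otimes> b) <#\<^bsub>G\<^esub> Q"
    then obtain q where q: "q \<in> Q" "y = a \<otimes> b \<otimes> q"
      by (auto simp: l_coset_def)
    \<comment> \<open>Since \<open>\<one> \<in> Q\<close>, the coset of the product lies inside the
      product of the cosets, so this half of the Hausdorff bound holds with distance 0.\<close>
    then have "y = a \<otimes> \<one> \<otimes> (b \<otimes> q)" "y \<in> carrier G"
      using a b by (auto simp: m_assoc)
    then have "y \<in> (a <#\<^bsub>G\<^esub> Q) <#> (b <#\<^bsub>G\<^esub> Q)"
      using q(1) by (auto simp: set_mult_def l_coset_def)
    moreover have "word_dist G S y y = 0"
      using \<open>y \<in> carrier G\<close> by (simp add: word_dist_def word_norm_one)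
    ultimately show "\<exists>x\<in>(a <#\<^bsub>G\<^esub> Q) <#> (b <#\<^bsub>G\<^esub> Q). word_dist G S x y \<le> 2 * c * \<bar>b\<bar>\<^sub>S"
      by (intro bexI[of _ y]) auto
  qed
  have "ereal_of_enat (hausdorff_dist G S ((a <#\<^bsub>G\<^esub> Q) <#> (b <#\<^bsub>G\<^esub> Q)) ((a \<otimes> b) <#\<^bsub>G\<^esub> Q))
      \<le> ereal (2 * real_of_int (int c) * real \<bar>b\<bar>\<^sub>S)"
    if "a \<in> carrier G" "b \<in> carrier G" for a b
  proof -
    have "ereal_of_enat (hausdorff_dist G S ((a <#\<^bsub>G\<^esub> Q) <#> (b <#\<^bsub>G\<^esub> Q)) ((a \<otimes> b) <#\<^bsub>G\<^esub> Q))
        \<le> ereal_of_enat (enat (2 * c * \<bar>b\<bar>\<^sub>S))"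
      using D[OF that] by (simp only: ereal_of_enat_le_iff)
    then show ?thesis by simp
  qed
  then show ?thesis
    unfolding quasi_hom_def using fiber_l_coset[OF sub]
    by (auto intro!: exI[of _ "int c"])
qed

lemma quasi_kernel_l_coset:
  assumes "subgroup Q G"
  shows "quasi_kernel G (\<lambda>g. g <#\<^bsub>G\<^esub> Q) = Q"
  using fiber_l_coset[OF assms one_closed] subgroup.subset[OF assms]
  by (simp add: quasi_kernel_def lcos_mult_one)

end

text \<open>The value type of \<open>\<phi>\<close> cannot be bound by an existential quantifier.
  Existence is therefore asserted with subsets of \<open>G\<close> as values, which suits the coset
  map, while the converse and the kernel criterion are asserted for an arbitrary value type
  \<open>'l\<close>.\<close>

theorem theorem19:
  fixes G :: "('a, 'm) monoid_scheme" and S Q :: "'a set"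
  assumes "group G"
    and "finite S" and "S \<subseteq> carrier G" and "generate G S = carrier G"
    and "Q \<subseteq> carrier G"
  shows "(quasi_normal Q G \<longleftrightarrow>
           (\<exists>(L :: 'a set set) \<phi>. quasi_hom G S L \<phi> \<and> Q = quasi_kernel G \<phi>))
       \<and> ((\<exists>(L :: 'l set) \<phi>. quasi_hom G S L \<phi> \<and> Q = quasi_kernel G \<phi>)
            \<longrightarrow> quasi_normal Q G)
       \<and> (\<forall>(L :: 'l set) \<phi>. quasi_hom G S L \<phi> \<longrightarrow>
            (Q = quasi_kernel G \<phi> \<longleftrightarrow> Q = invariant_set G \<phi>))"
proof -
  interpret finitely_generated_group G S
    using assms by (simp add: finitely_generated_group_def finitely_generated_group_axioms_def)
  have "\<exists>(L :: 'a set set) \<phi>. quasi_hom G S L \<phi> \<and> Q = quasi_kernel G \<phi>" if "quasi_normal Q G"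
    using quasi_hom_l_coset[OF that] quasi_kernel_l_coset that unfolding quasi_normal_def by metis
  then show ?thesis
    using quasi_normal_quasi_kernel quasi_kernel_eq_invariant_set by metis
qed

end
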